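(* Assume that, in the standard distribution-testing model, the sample complexity of testing whether a distribution over a domain of size $O(m)$ is $m$-grained is $\Omega(m/\log m)$. Then for every $m\le 2^{n-\Omega(n)}$, testing (with some constant proximity parameter $\epsilon>0$) whether a distribution over $\{0,1\}^n$ is $m$-grained requires $\Omega(m/\log m)$ samples in the DoHO model.
   Context: A distribution $P$ is $m$-grained if $P(x)$ is an integer multiple of $1/m$ for every $x$. In the standard distribution-testing model, a tester receives independent full samples of an unknown distribution and must accept members of the property with probability at least $2/3$ and reject distributions that are $\epsilon$-far in total variation distance from the property with probability at least $2/3$. For $x,y\in\{0,1\}^n$ let $\Delta_H(x,y)=\frac1n|\{i:x_i\neq y_i\}|$. The DoHO-model distance between distributions $P,Q$ over $\{0,1\}^n$ is $\min\sum_{x,y}w_{x,y}\Delta_H(x,y)$ over nonnegative $w_{x,y}$ with $\sum_y w_{x,y}=P(x)$, $\sum_x w_{x,y}=Q(y)$. A DoHO-model tester gets oracle access to independent samples of $P$ over $\{0,1\}^n$, may query individual bits of samples, and must accept members with probability at least $2/3$ and reject distributions $\epsilon$-far (in the DoHO distance) from the property with probability at least $2/3$. $m\le 2^{n-\Omega(n)}$ means $m\le 2^{(1-c)n}$ for a fixed constant $c>0$. *)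

theory Defs
  imports "HOL-Probability.Probability" "HOL-Library.Landau_Symbols"
begin

text \<open>Distributions over a finite domain \<open>D\<close> are probability mass functions whose support
  is contained in \<open>D\<close>.\<close>

definition grained :: "'a set \<Rightarrow> nat \<Rightarrow> 'a pmf set" where
  "grained D m = {P. set_pmf P \<subseteq> D \<and> (\<forall>x. \<exists>j::int. pmf P x = real_of_int j * (1 / real m))}"

definition eps_far :: "('a pmf \<Rightarrow> 'a pmf \<Rightarrow> real) \<Rightarrow> 'a pmf set \<Rightarrow> real \<Rightarrow> 'a pmf \<Rightarrow> bool" where
  "eps_far d \<P> \<epsilon> P \<longleftrightarrow> (\<forall>Q\<in>\<P>. d P Q > \<epsilon>)"

text \<open>\<open>out P\<close> is the distribution of the verdict (\<open>True\<close> means accept) of a tester that is run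
  on the unknown distribution \<open>P\<close>.\<close>

definition is_tester ::
  "'a set \<Rightarrow> ('a pmf \<Rightarrow> 'a pmf \<Rightarrow> real) \<Rightarrow> 'a pmf set \<Rightarrow> real \<Rightarrow> ('a pmf \<Rightarrow> bool pmf) \<Rightarrow> bool" where
  "is_tester D d \<P> \<epsilon> out \<longleftrightarrow>
     (\<forall>P. set_pmf P \<subseteq> D \<longrightarrow>
        (P \<in> \<P> \<longrightarrow> pmf (out P) True \<ge> 2 / 3) \<and>
        (eps_far d \<P> \<epsilon> P \<longrightarrow> pmf (out P) False \<ge> 2 / 3))"


section \<open>The standard model\<close>

definition tv_dist :: "'a set \<Rightarrow> 'a pmf \<Rightarrow> 'a pmf \<Rightarrow> real" where
  "tv_dist D P Q = 1 / 2 * (\<Sum>x\<in>D. \<bar>pmf P x - pmf Q x\<bar>)"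

definition std_out :: "nat \<Rightarrow> ('a list \<Rightarrow> bool pmf) \<Rightarrow> 'a pmf \<Rightarrow> bool pmf" where
  "std_out s T P = bind_pmf (replicate_pmf s P) T"

text \<open>The sample complexities below are infima of sets of natural numbers, taken in the extended
  reals; the value is \<open>\<infinity>\<close> if no tester exists. Testers may depend arbitrarily on the parameters.\<close>

definition std_sample_complexity :: "'a set \<Rightarrow> 'a pmf set \<Rightarrow> real \<Rightarrow> ereal" where
  "std_sample_complexity D \<P> \<epsilon> =
     (INF s\<in>{s. \<exists>T. is_tester D (tv_dist D) \<P> \<epsilon> (std_out s T)}. ereal (real s))"


section \<open>The DoHO model\<close>

definition bitstrings :: "nat \<Rightarrow> bool list set" where
  "bitstrings n = {x. length x = n}"

definition rel_hamming :: "nat \<Rightarrow> bool list \<Rightarrow> bool list \<Rightarrow> real" where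
  "rel_hamming n x y = 1 / real n * real (card {i. i < n \<and> x ! i \<noteq> y ! i})"

definition transports ::
  "nat \<Rightarrow> bool list pmf \<Rightarrow> bool list pmf \<Rightarrow> (bool list \<Rightarrow> bool list \<Rightarrow> real) set" where
  "transports n P Q =
     {w. (\<forall>x\<in>bitstrings n. \<forall>y\<in>bitstrings n. w x y \<ge> 0) \<and>
         (\<forall>x\<in>bitstrings n. (\<Sum>y\<in>bitstrings n. w x y) = pmf P x) \<and>
         (\<forall>y\<in>bitstrings n. (\<Sum>x\<in>bitstrings n. w x y) = pmf Q y)}"

text \<open>The infimum is a minimum: a linear function is minimised over a nonempty compact polytope.\<close>

definition doho_dist :: "nat \<Rightarrow> bool list pmf \<Rightarrow> bool list pmf \<Rightarrow> real" where
  "doho_dist n P Q =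
     (INF w\<in>transports n P Q.
        \<Sum>x\<in>bitstrings n. \<Sum>y\<in>bitstrings n. w x y * rel_hamming n x y)"

text \<open>A deterministic adaptive algorithm: \<open>Query i j f\<close> reads bit \<open>j\<close> of sample \<open>i\<close> and continues
  with \<open>f b\<close> if the answer is \<open>b\<close>. A DoHO tester is a probability distribution over such
  algorithms. There are only countably many of them, so that nothing is lost by using \<open>pmf\<close>.\<close>

datatype query_alg = Verdict bool | Query nat nat "bool \<Rightarrow> query_alg"

primrec run :: "(nat \<Rightarrow> nat \<Rightarrow> bool) \<Rightarrow> query_alg \<Rightarrow> bool" where
  "run oracle_bit (Verdict v) = v"
| "run oracle_bit (Query i j f) = run oracle_bit (f (oracle_bit i j))"

primrec queries_within :: "nat \<Rightarrow> nat \<Rightarrow> query_alg \<Rightarrow> bool" where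
  "queries_within s n (Verdict v) \<longleftrightarrow> True"
| "queries_within s n (Query i j f) \<longleftrightarrow> i < s \<and> j < n \<and> (\<forall>b. queries_within s n (f b))"

definition doho_out :: "nat \<Rightarrow> query_alg pmf \<Rightarrow> bool list pmf \<Rightarrow> bool pmf" where
  "doho_out s T P =
     do {A \<leftarrow> T; xs \<leftarrow> replicate_pmf s P; return_pmf (run (\<lambda>i j. xs ! i ! j) A)}"

definition doho_sample_complexity :: "nat \<Rightarrow> bool list pmf set \<Rightarrow> real \<Rightarrow> ereal" where
  "doho_sample_complexity n \<P> \<epsilon> =
     (INF s\<in>{s. \<exists>T. (\<forall>A\<in>set_pmf T. queries_within s n A) \<and>
                    is_tester (bitstrings n) (doho_dist n) \<P> \<epsilon> (doho_out s T)}. ereal (real s))"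

end

(* Compose a standard distribution on a domain of size O(m) with a code C of constant relative
   distance delta in {0,1}^n; such a code exists because m <= 2^((1 - gamma) n) leaves room for the
   Gilbert-Varshamov bound. Encoding preserves grainedness. Decoding maps grained distributions to
   grained ones as well, and changing the decoded value costs a transport at least delta / 2, so
   distances from the property shrink by at most this factor. Hence a DoHO tester yields a standard
   tester with the same number of samples. For the finitely many m that the hypothesis does not
   cover, at least one sample is needed, since some distribution on the repetition code is far from
   being m-grained. *)
theory Submission
  imports Defs "HOL-Real_Asymp.Real_Asymp"
begin

section \<open>Push-forwards of grained distributions\<close>

text \<open>The fibre of y is written as an indicator over all of D, so that later sums over fibres
  can be swapped and subtracted freely.\<close>

lemma pmf_map_finite_support:
  assumes "finite D" "set_pmf P \<subseteq> D"
  shows "pmf (map_pmf f P) y = (\<Sum>x\<in>D. pmf P x * of_bool (f x = y))"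
proof -
  have "pmf (map_pmf f P) y = measure P (f -` {y} \<inter> set_pmf P)"
    by (simp add: pmf_map measure_Int_set_pmf)
  also have "f -` {y} \<inter> set_pmf P = {x\<in>D. f x = y} \<inter> set_pmf P"
    using assms by auto
  also have "measure P \<dots> = measure P {x\<in>D. f x = y}"
    by (simp add: measure_Int_set_pmf)
  also have "\<dots> = (\<Sum>x\<in>{x\<in>D. f x = y}. pmf P x)"
    using assms by (intro measure_measure_pmf_finite) auto
  also have "\<dots> = (\<Sum>x\<in>D. pmf P x * of_bool (f x = y))"
    using assms by (simp add: sum.inter_filter of_bool_def if_distrib cong: if_cong)
  finally show ?thesis .
qed

text \<open>A mass of the push-forward is a sum of masses over a fibre, and a sum of multiples of
  1/m is again one. As f may merge points, this serves decoding as well as encoding.\<close>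

lemma grained_map_pmf:
  assumes "finite D" "P \<in> grained D m" "f ` D \<subseteq> E"
  shows "map_pmf f P \<in> grained E m"
proof -
  have D: "set_pmf P \<subseteq> D" using assms by (auto simp: grained_def)
  obtain j :: "_ \<Rightarrow> int" where j: "\<And>x. pmf P x = real_of_int (j x) * (1 / real m)"
    using assms(2) unfolding grained_def by simp metis
  have "\<exists>i::int. pmf (map_pmf f P) y = real_of_int i * (1 / real m)" for y
    by (rule exI[of _ "\<Sum>x\<in>D. j x * of_bool (f x = y)"])
      (simp add: pmf_map_finite_support[OF assms(1) D] j sum_divide_distrib)
  then show ?thesis using D assms(3) by (auto simp: grained_def)
qed

lemma return_pmf_grained:
  assumes "x \<in> D" "m > 0"
  shows "return_pmf x \<in> grained D m"
proof -
  have "\<exists>j::int. pmf (return_pmf x) y = real_of_int j * (1 / real m)" for y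
    using assms
    by (intro exI[of _ "if y = x then int m else 0"]) (auto simp: pmf_return)
  then show ?thesis using assms unfolding grained_def by simp
qed

lemma replicate_pmf_map_pmf: "replicate_pmf s (map_pmf f P) = map_pmf (map f) (replicate_pmf s P)"
  by (induction s) (simp_all add: map_pmf_def bind_assoc_pmf bind_return_pmf)

section \<open>Transport distance and total variation\<close>

lemma finite_bitstrings [simp]: "finite (bitstrings n)"
  and card_bitstrings: "card (bitstrings n) = 2 ^ n"
  using finite_lists_length_eq[of "UNIV :: bool set" n] card_lists_length_eq[of "UNIV :: bool set" n]
  by (simp_all add: bitstrings_def)

lemma rel_hamming_nonneg: "0 \<le> rel_hamming n x y"
  by (simp add: rel_hamming_def)

lemma rel_hamming_commute: "rel_hamming n x y = rel_hamming n y x"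
  by (simp add: rel_hamming_def eq_commute)

lemma rel_hamming_triangle: "rel_hamming n x z \<le> rel_hamming n x y + rel_hamming n y z"
proof -
  have "card {i. i < n \<and> x ! i \<noteq> z ! i} \<le> card ({i. i < n \<and> x ! i \<noteq> y ! i} \<union> {i. i < n \<and> y ! i \<noteq> z ! i})"
    by (intro card_mono) auto
  also have "\<dots> \<le> card {i. i < n \<and> x ! i \<noteq> y ! i} + card {i. i < n \<and> y ! i \<noteq> z ! i}"
    by (rule card_Un_le)
  finally show ?thesis
    unfolding rel_hamming_def
    by (metis (no_types, lifting) distrib_left divide_nonneg_nonneg mult_left_mono of_nat_0_le_iff
        of_nat_add of_nat_mono zero_le_one)
qed

text \<open>The product of the two distributions is a transport. Bounding the infimum in
  \<open>doho_dist\<close> from below with \<open>cINF_greatest\<close> requires a nonempty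
  set.\<close>

lemma transports_nonempty:
  assumes "set_pmf A \<subseteq> bitstrings n" "set_pmf B \<subseteq> bitstrings n"
  shows "transports n A B \<noteq> {}"
proof -
  have "(\<lambda>x y. pmf A x * pmf B y) \<in> transports n A B"
    using assms
    by (auto simp: transports_def sum_pmf_eq_1 simp flip: sum_distrib_left sum_distrib_right)
  then show ?thesis by blast
qed

text \<open>Coupling inequality: mass moved between points with equal f-values leaves the
  push-forward unchanged, and a unit moved between different values changes the sum of absolute
  differences by at most 2, which the factor 1/2 in \<open>tv_dist\<close> absorbs.\<close>

lemma tv_dist_map_pmf_le:
  assumes w: "w \<in> transports n A B" and "finite D"
    and A: "set_pmf A \<subseteq> bitstrings n" and B: "set_pmf B \<subseteq> bitstrings n"
  shows "tv_dist D (map_pmf f A) (map_pmf f B)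
    \<le> (\<Sum>x\<in>bitstrings n. \<Sum>y\<in>bitstrings n. w x y * of_bool (f x \<noteq> f y))"
proof -
  let ?S = "bitstrings n"
  have w0: "w x y \<ge> 0" if "x \<in> ?S" "y \<in> ?S" for x y
    using w that by (auto simp: transports_def)
  have wA: "pmf A x = (\<Sum>y\<in>?S. w x y)" if "x \<in> ?S" for x
    using w that by (auto simp: transports_def)
  have wB: "pmf B y = (\<Sum>x\<in>?S. w x y)" if "y \<in> ?S" for y
    using w that by (auto simp: transports_def)
  have fA: "pmf (map_pmf f A) j = (\<Sum>x\<in>?S. \<Sum>y\<in>?S. w x y * of_bool (f x = j))" for j
    by (simp add: pmf_map_finite_support[OF _ A] wA sum_distrib_right)
  have fB: "pmf (map_pmf f B) j = (\<Sum>x\<in>?S. \<Sum>y\<in>?S. w x y * of_bool (f y = j))" for j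
    by (subst sum.swap) (simp add: pmf_map_finite_support[OF _ B] wB sum_distrib_right)
  \<comment> \<open>Only j = a and j = b can contribute, at most 1 each; this is merely an upper
    bound because a or b may lie outside D.\<close>
  have diff: "(\<Sum>j\<in>D. \<bar>of_bool (a = j) - of_bool (b = j)\<bar>) \<le> (2 * of_bool (a \<noteq> b) :: real)" for a b
  proof (cases "a = b")
    case False
    have "(\<Sum>j\<in>D. \<bar>of_bool (a = j) - of_bool (b = j)\<bar>)
      \<le> (\<Sum>j\<in>D. of_bool (a = j) + of_bool (b = j) :: real)"
      by (intro sum_mono) auto
    also have "\<dots> \<le> 2"
      using \<open>finite D\<close> by (simp add: sum.distrib of_bool_def)
    finally show ?thesis using False by simp
  qed simp
  have "(\<Sum>j\<in>D. \<bar>pmf (map_pmf f A) j - pmf (map_pmf f B) j\<bar>)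
    \<le> (\<Sum>j\<in>D. \<Sum>x\<in>?S. \<Sum>y\<in>?S. w x y * \<bar>of_bool (f x = j) - of_bool (f y = j)\<bar>)"
  proof (rule sum_mono)
    fix j
    have "\<bar>pmf (map_pmf f A) j - pmf (map_pmf f B) j\<bar>
      = \<bar>\<Sum>x\<in>?S. \<Sum>y\<in>?S. w x y * (of_bool (f x = j) - of_bool (f y = j))\<bar>"
      by (simp only: fA fB right_diff_distrib sum_subtractf)
    also have "\<dots> \<le> (\<Sum>x\<in>?S. \<Sum>y\<in>?S. \<bar>w x y * (of_bool (f x = j) - of_bool (f y = j))\<bar>)"
      by (rule order_trans[OF sum_abs sum_mono[OF sum_abs]])
    also have "\<dots> = (\<Sum>x\<in>?S. \<Sum>y\<in>?S. w x y * \<bar>of_bool (f x = j) - of_bool (f y = j)\<bar>)"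
      using w0 by (intro sum.cong refl) (simp add: abs_mult)
    finally show "\<bar>pmf (map_pmf f A) j - pmf (map_pmf f B) j\<bar> \<le> \<dots>" .
  qed
  also have "\<dots> = (\<Sum>x\<in>?S. \<Sum>y\<in>?S. w x y * (\<Sum>j\<in>D. \<bar>of_bool (f x = j) - of_bool (f y = j)\<bar>))"
    by (subst sum.swap, intro sum.cong refl, subst sum.swap) (simp add: sum_distrib_left)
  also have "\<dots> \<le> (\<Sum>x\<in>?S. \<Sum>y\<in>?S. w x y * (2 * of_bool (f x \<noteq> f y)))"
    using w0 diff by (intro sum_mono mult_left_mono) auto
  also have "\<dots> = 2 * (\<Sum>x\<in>?S. \<Sum>y\<in>?S. w x y * of_bool (f x \<noteq> f y))"
    by (simp add: sum_distrib_left mult.left_commute del: sum_mult_of_bool_eq)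
  finally show ?thesis by (simp add: tv_dist_def)
qed

section \<open>Decoding, and the reduction between the two models\<close>

definition is_code :: "nat \<Rightarrow> nat \<Rightarrow> real \<Rightarrow> (nat \<Rightarrow> bool list) \<Rightarrow> bool" where
  "is_code n k \<delta> C \<longleftrightarrow> C ` {..<k} \<subseteq> bitstrings n \<and>
     (\<forall>i<k. \<forall>j<k. i \<noteq> j \<longrightarrow> rel_hamming n (C i) (C j) > \<delta>)"

text \<open>The witness is the push-forward of Q under decoding. The mass of
  \<open>map_pmf C P\<close> starts at codewords, and a target whose decoded value differs from that
  of its origin is more than \<delta>/2 away from it, so each unit of mass that changes its decoded
  value costs at least \<delta>/2.\<close>

lemma code_doho_dist:
  assumes C: "is_code n k \<delta> C" and "\<delta> > 0" "k > 0"
    and P: "set_pmf P \<subseteq> {..<k}" and Q: "Q \<in> grained (bitstrings n) m"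
  obtains Q' where "Q' \<in> grained {..<k} m"
    and "\<delta> / 2 * tv_dist {..<k} P Q' \<le> doho_dist n (map_pmf C P) Q"
proof -
  let ?S = "bitstrings n"
  \<comment> \<open>The default 0 for words far from the code is a valid index because k > 0, so
    decoding always lands in the domain.\<close>
  define dec where "dec y = (if \<exists>i<k. rel_hamming n (C i) y \<le> \<delta> / 2
    then SOME i. i < k \<and> rel_hamming n (C i) y \<le> \<delta> / 2 else 0)" for y
  have some: "dec y < k \<and> rel_hamming n (C (dec y)) y \<le> \<delta> / 2"
    if "\<exists>i<k. rel_hamming n (C i) y \<le> \<delta> / 2" for y
    using someI_ex[OF that] that by (simp add: dec_def)
  have dec_less: "dec y < k" for y
    using some[of y] \<open>k > 0\<close> by (cases "\<exists>i<k. rel_hamming n (C i) y \<le> \<delta> / 2") (auto simp: dec_def)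
  \<comment> \<open>Closed balls of radius \<delta>/2 around distinct codewords are disjoint, since
    codewords are strictly more than \<delta> apart.\<close>
  have dec_eq: "dec y = i" if "i < k" "rel_hamming n (C i) y \<le> \<delta> / 2" for i y
  proof (rule ccontr)
    assume "dec y \<noteq> i"
    then have "rel_hamming n (C i) (C (dec y)) > \<delta>"
      using C that dec_less by (auto simp: is_code_def)
    moreover have "rel_hamming n (C i) (C (dec y))
      \<le> rel_hamming n (C i) y + rel_hamming n (C (dec y)) y"
      using rel_hamming_triangle[of n "C i" "C (dec y)" y] rel_hamming_commute by metis
    ultimately show False using some[of y] that by fastforce
  qed
  have dec_C: "dec (C i) = i" if "i < k" for i
    using dec_eq[of i "C i"] that \<open>\<delta> > 0\<close> by (simp add: rel_hamming_def)
  have A: "set_pmf (map_pmf C P) \<subseteq> ?S" using P C by (auto simp: is_code_def)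
  have B: "set_pmf Q \<subseteq> ?S" using Q by (auto simp: grained_def)
  have "map_pmf dec (map_pmf C P) = map_pmf id P"
    unfolding pmf.map_comp by (rule map_pmf_cong) (use P dec_C in auto)
  then have decP: "map_pmf dec (map_pmf C P) = P" by (simp add: pmf.map_id)
  have "map_pmf dec Q \<in> grained {..<k} m"
    using Q dec_less by (intro grained_map_pmf[of ?S]) auto
  moreover have "\<delta> / 2 * tv_dist {..<k} P (map_pmf dec Q) \<le> doho_dist n (map_pmf C P) Q"
    unfolding doho_dist_def
  proof (rule cINF_greatest[OF transports_nonempty[OF A B]])
    fix w assume w: "w \<in> transports n (map_pmf C P) Q"
    have bound: "\<delta> / 2 * (w x y * of_bool (dec x \<noteq> dec y)) \<le> w x y * rel_hamming n x y"
      if xy: "x \<in> ?S" "y \<in> ?S" for x y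
    proof (cases "x \<in> C ` {..<k}")
      case True
      then obtain i where i: "i < k" "x = C i" by auto
      have "\<delta> / 2 * of_bool (dec x \<noteq> dec y) \<le> rel_hamming n x y"
        using dec_eq[OF i(1), of y] dec_C[OF i(1)] i rel_hamming_nonneg[of n x y]
        by (cases "rel_hamming n x y \<le> \<delta> / 2") auto
      moreover have "w x y \<ge> 0" using w xy by (auto simp: transports_def)
      ultimately have "w x y * (\<delta> / 2 * of_bool (dec x \<noteq> dec y)) \<le> w x y * rel_hamming n x y"
        by (rule mult_left_mono)
      then show ?thesis by (simp add: mult_ac)
    next
      case False
      \<comment> \<open>No mass starts at a word that is not a codeword: the row of w at x sums to
        0, so its nonnegative entries vanish.\<close>
      then have "pmf (map_pmf C P) x = 0" using P by (auto simp: pmf_eq_0_set_pmf)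
      then have "(\<Sum>y\<in>?S. w x y) = 0" using w xy by (auto simp: transports_def)
      then have "w x y = 0"
        using w xy by (subst (asm) sum_nonneg_eq_0_iff) (auto simp: transports_def)
      then show ?thesis by simp
    qed
    have "\<delta> / 2 * tv_dist {..<k} P (map_pmf dec Q)
      \<le> \<delta> / 2 * (\<Sum>x\<in>?S. \<Sum>y\<in>?S. w x y * of_bool (dec x \<noteq> dec y))"
      using tv_dist_map_pmf_le[OF w _ A B, of "{..<k}" dec] \<open>\<delta> > 0\<close>
      by (intro mult_left_mono) (auto simp: decP)
    also have "\<dots> \<le> (\<Sum>x\<in>?S. \<Sum>y\<in>?S. w x y * rel_hamming n x y)"
      unfolding sum_distrib_left by (intro sum_mono bound)
    finally show "\<delta> / 2 * tv_dist {..<k} P (map_pmf dec Q)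
      \<le> (\<Sum>x\<in>?S. \<Sum>y\<in>?S. w x y * rel_hamming n x y)" .
  qed
  ultimately show ?thesis by (rule that)
qed

text \<open>The simulation encodes each sample and runs the DoHO algorithm on the codewords, so s is
  unchanged. Grained inputs stay grained; far inputs stay far up to the factor \<delta>/2, which the
  bound on \<epsilon> allows for.\<close>

lemma std_tester_of_doho_tester:
  assumes C: "is_code n k \<delta> C" and "\<delta> > 0" "k > 0"
    and T: "is_tester (bitstrings n) (doho_dist n) (grained (bitstrings n) m) \<epsilon> (doho_out s T)"
    and \<epsilon>: "\<epsilon> \<le> \<delta> / 2 * \<epsilon>\<^sub>0"
  shows "\<exists>T'. is_tester {..<k} (tv_dist {..<k}) (grained {..<k} m) \<epsilon>\<^sub>0 (std_out s T')"
proof -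
  define T' where "T' xs = map_pmf (run (\<lambda>i j. map C xs ! i ! j)) T" for xs
  have out: "std_out s T' P = doho_out s T (map_pmf C P)" for P
  proof -
    have "std_out s T' P
      = do {xs \<leftarrow> replicate_pmf s P; A \<leftarrow> T; return_pmf (run (\<lambda>i j. map C xs ! i ! j) A)}"
      by (simp add: std_out_def T'_def[abs_def] map_pmf_def)
    \<comment> \<open>\<open>doho_out\<close> draws the algorithm first, the simulation draws it
      last; the draws are independent and can be exchanged.\<close>
    also have "\<dots> = do {A \<leftarrow> T; xs \<leftarrow> replicate_pmf s P; return_pmf (run (\<lambda>i j. map C xs ! i ! j) A)}"
      by (rule bind_commute_pmf)
    also have "\<dots> = doho_out s T (map_pmf C P)"
      by (simp add: doho_out_def replicate_pmf_map_pmf bind_map_pmf)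
    finally show ?thesis .
  qed
  have "is_tester {..<k} (tv_dist {..<k}) (grained {..<k} m) \<epsilon>\<^sub>0 (std_out s T')"
    unfolding is_tester_def out
  proof (intro allI impI conjI)
    fix P assume P: "set_pmf P \<subseteq> {..<k}"
    then have CP: "set_pmf (map_pmf C P) \<subseteq> bitstrings n" using C by (auto simp: is_code_def)
    {
      assume "P \<in> grained {..<k} m"
      then have "map_pmf C P \<in> grained (bitstrings n) m"
        using C by (intro grained_map_pmf[of "{..<k}"]) (auto simp: is_code_def)
      then show "2 / 3 \<le> pmf (doho_out s T (map_pmf C P)) True"
        using T CP by (auto simp: is_tester_def)
    next
      assume far: "eps_far (tv_dist {..<k}) (grained {..<k} m) \<epsilon>\<^sub>0 P"
      have "eps_far (doho_dist n) (grained (bitstrings n) m) \<epsilon> (map_pmf C P)"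
        unfolding eps_far_def
      proof
        fix Q assume "Q \<in> grained (bitstrings n) m"
        then obtain Q' where Q': "Q' \<in> grained {..<k} m"
          and le: "\<delta> / 2 * tv_dist {..<k} P Q' \<le> doho_dist n (map_pmf C P) Q"
          using code_doho_dist[OF C \<open>\<delta> > 0\<close> \<open>k > 0\<close> P] by blast
        have "\<epsilon>\<^sub>0 < tv_dist {..<k} P Q'" using far Q' by (auto simp: eps_far_def)
        then have "\<delta> / 2 * \<epsilon>\<^sub>0 < \<delta> / 2 * tv_dist {..<k} P Q'" using \<open>\<delta> > 0\<close> by simp
        then show "\<epsilon> < doho_dist n (map_pmf C P) Q" using le \<epsilon> by linarith
      qed
      then show "2 / 3 \<le> pmf (doho_out s T (map_pmf C P)) False"
        using T CP by (auto simp: is_tester_def)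
    }
  qed
  then show ?thesis by blast
qed

section \<open>Codes of constant relative distance\<close>

text \<open>Weigh each y by t to the power of its number of disagreements with x. As t < 1, every
  point of the ball weighs at least t^(\<delta> n), while the whole cube weighs (1 + t)^n.\<close>

lemma card_hamming_ball:
  assumes "0 < t" "t < 1" "x \<in> bitstrings n"
  shows "real (card {y \<in> bitstrings n. rel_hamming n x y \<le> \<delta>}) \<le> (1 + t) ^ n * t powr (- \<delta> * n)"
proof -
  let ?B = "{y \<in> bitstrings n. rel_hamming n x y \<le> \<delta>}"
  let ?d = "\<lambda>y. {i. i < n \<and> x ! i \<noteq> y ! i}"
  have "real (card ?B) * t powr (\<delta> * n) = (\<Sum>y\<in>?B. t powr (\<delta> * n))" by simp
  also have "\<dots> \<le> (\<Sum>y\<in>?B. t ^ card (?d y))"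
  proof (rule sum_mono)
    fix y assume y: "y \<in> ?B"
    have "real (card (?d y)) \<le> \<delta> * n"
    \<comment> \<open>Clearing the denominator of \<open>rel_hamming\<close> needs n > 0; for n = 0
      both sides are 0.\<close>
    proof (cases "n = 0")
      case False
      then show ?thesis using y by (simp add: rel_hamming_def field_simps)
    qed simp
    then have "t powr (\<delta> * n) \<le> t powr real (card (?d y))"
      using assms by (intro powr_mono') auto
    then show "t powr (\<delta> * n) \<le> t ^ card (?d y)" using assms by (simp add: powr_realpow)
  qed
  \<comment> \<open>A word is determined by the positions where it differs from x, so the sum may
    run over sets of positions.\<close>
  also have "\<dots> = (\<Sum>X\<in>?d ` ?B. t ^ card X)"
  proof (rule sum.reindex[symmetric, unfolded comp_def])
    show "inj_on ?d ?B"
    proof (rule inj_onI)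
      fix y z assume y: "y \<in> ?B" and z: "z \<in> ?B" and eq: "?d y = ?d z"
      have "y ! i = z ! i" if "i < n" for i
        using eq that by (auto simp: set_eq_iff)
      then show "y = z" using y z by (auto simp: bitstrings_def intro: nth_equalityI)
    qed
  qed
  also have "\<dots> \<le> (\<Sum>X\<in>Pow {..<n}. t ^ card X)"
    using assms by (intro sum_mono2) auto
  also have "\<dots> = (1 + t) ^ n"
    using prod_add[of "{..<n}" "\<lambda>_. t" "\<lambda>_. 1"] by (simp add: add.commute)
  finally have "real (card ?B) * t powr (\<delta> * n) \<le> (1 + t) ^ n" .
  then show ?thesis using assms by (simp add: powr_minus field_simps)
qed

text \<open>Greedy choice: (k + 1) V <= 2^n with V > 0 gives k V < 2^n, so the balls around k
  codewords miss some word, which becomes the next codeword.\<close>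

lemma gilbert_varshamov:
  assumes ball: "\<And>x. x \<in> bitstrings n \<Longrightarrow> real (card {y \<in> bitstrings n. rel_hamming n x y \<le> \<delta>}) \<le> V"
    and "V > 0" and "real k * V \<le> 2 ^ n"
  shows "\<exists>C. is_code n k \<delta> C"
  using assms(3)
proof (induction k)
  case (Suc k)
  have less: "real k * V < 2 ^ n" using Suc.prems \<open>V > 0\<close> by (simp add: algebra_simps)
  then obtain C where C: "is_code n k \<delta> C" using Suc.IH by auto
  let ?B = "\<lambda>i. {y \<in> bitstrings n. rel_hamming n (C i) y \<le> \<delta>}"
  have "real (card (\<Union>i<k. ?B i)) \<le> (\<Sum>i<k. real (card (?B i)))"
    using card_UN_le[of "{..<k}" ?B] by (simp flip: of_nat_sum)
  also have "\<dots> \<le> (\<Sum>i<k. V)"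
    using C by (intro sum_mono ball) (auto simp: is_code_def)
  also have "\<dots> < 2 ^ n" using less by simp
  finally have "card (\<Union>i<k. ?B i) < card (bitstrings n)"
    by (simp add: card_bitstrings)
  moreover have "finite (\<Union>i<k. ?B i)" by simp
  ultimately have "\<not> bitstrings n \<subseteq> (\<Union>i<k. ?B i)" using card_mono not_le by blast
  then obtain z where z: "z \<in> bitstrings n" "z \<notin> (\<Union>i<k. ?B i)" by blast
  have "is_code n (Suc k) \<delta> (C(k := z))"
    using C z by (auto simp: is_code_def less_Suc_eq rel_hamming_commute[of n z] not_le)
  then show ?case by blast
qed (auto simp: is_code_def[abs_def])

text \<open>Here \<delta> depends on \<gamma> alone. The balls use up half of the \<gamma> n spare
  bits; the other half is left for the constant factor in the domain size.\<close>

lemma constant_distance_codes: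
  assumes "0 < \<gamma>" "\<gamma> < 1"
  obtains \<delta> where "\<delta> > 0"
    and "\<And>n k. real k * 2 powr (\<gamma> / 2 * real n) \<le> 2 ^ n \<Longrightarrow> \<exists>C. is_code n k \<delta> C"
proof -
  \<comment> \<open>Chosen so that (1 + t)^n is 2^(\<gamma> n/4); then \<delta> is chosen so that
    \<open>t powr (- \<delta> * n)\<close> is 2^(\<gamma> n/4) too, and the ball bound becomes
    2^(\<gamma> n/2).\<close>
  define t where "t = 2 powr (\<gamma> / 4) - (1::real)"
  have "2 powr 0 < 2 powr (\<gamma> / 4)" "2 powr (\<gamma> / 4) < (2::real) powr 1"
    using assms by (intro powr_less_mono; simp)+
  then have t: "0 < t" "t < 1" by (auto simp: t_def)
  define \<delta> where "\<delta> = \<gamma> / 4 / (- log 2 t)"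
  have lt: "log 2 t < 0" using t by simp
  have "\<delta> > 0" using assms lt by (simp add: \<delta>_def divide_pos_neg)
  moreover have "\<exists>C. is_code n k \<delta> C" if k: "real k * 2 powr (\<gamma> / 2 * real n) \<le> 2 ^ n" for n k
  proof (rule gilbert_varshamov[OF _ _ k])
    fix x assume "x \<in> bitstrings n"
    have "t powr (- \<delta> * n) = (2 powr log 2 t) powr (- \<delta> * n)" using t by simp
    also have "\<dots> = 2 powr (\<gamma> / 4 * n)"
      unfolding powr_powr using lt by (simp add: \<delta>_def)
    finally have 1: "t powr (- \<delta> * n) = 2 powr (\<gamma> / 4 * n)" .
    have 2: "(1 + t) ^ n = 2 powr (\<gamma> / 4 * n)"
      by (simp add: t_def powr_powr flip: powr_realpow)
    have "(1 + t) ^ n * t powr (- \<delta> * n) = 2 powr (\<gamma> / 2 * n)"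
      unfolding 1 2 by (simp flip: powr_add)
    then show "real (card {y \<in> bitstrings n. rel_hamming n x y \<le> \<delta>}) \<le> 2 powr (\<gamma> / 2 * n)"
      using card_hamming_ball[OF t \<open>x \<in> bitstrings n\<close>, of \<delta>] by simp
  qed simp
  ultimately show ?thesis by (rule that)
qed

section \<open>The lower bound\<close>

text \<open>A mass of 1/(2m) lies midway between consecutive multiples of 1/m. On two points this
  gives total variation at least 1/(4m), and the repetition code, used with \<delta> = 1/2, costs a
  further factor 1/4.\<close>

lemma exists_far_from_grained:
  assumes "n > 0" "m > 0" "\<epsilon> < 1 / (16 * real m)"
  obtains P where "set_pmf P \<subseteq> bitstrings n" "eps_far (doho_dist n) (grained (bitstrings n) m) \<epsilon> P"
proof -
  define C where "C i = replicate n (i = (0::nat))" for i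
  have C: "is_code n 2 (1 / 2) C"
    using \<open>n > 0\<close> by (auto simp: is_code_def C_def bitstrings_def rel_hamming_def less_2_cases_iff
        cong: conj_cong)
  define p where "p = 1 / (2 * real m)"
  have p: "0 \<le> p" "p \<le> 1" using \<open>m > 0\<close> by (auto simp: p_def)
  define P where "P = map_pmf (\<lambda>b. if b then 0 else 1 :: nat) (bernoulli_pmf p)"
  have P: "set_pmf P \<subseteq> {..<2}" by (auto simp: P_def)
  have P0: "pmf P 0 = p"
    unfolding P_def pmf_map_finite_support[OF finite subset_UNIV]
    using p by (simp add: UNIV_bool)
  have tv: "1 / (4 * real m) \<le> tv_dist {..<2} P Q'" if Q': "Q' \<in> grained {..<2} m" for Q'
  proof -
    obtain j :: int where j: "pmf Q' 0 = real_of_int j * (1 / real m)"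
      using Q' by (auto simp: grained_def)
    have "p - pmf Q' 0 = real_of_int (1 - 2 * j) / (2 * real m)"
      using \<open>m > 0\<close> by (simp add: p_def j field_simps)
    moreover have "1 \<le> \<bar>real_of_int (1 - 2 * j)\<bar>"
    proof -
      \<comment> \<open>An odd integer is nonzero.\<close>
      have "1 \<le> \<bar>1 - 2 * j\<bar>" by presburger
      then show ?thesis by (simp only: of_int_1_le_iff flip: of_int_abs)
    qed
    ultimately have "1 / (2 * real m) \<le> \<bar>pmf P 0 - pmf Q' 0\<bar>"
      using \<open>m > 0\<close> by (simp add: P0 abs_divide divide_right_mono)
    then show ?thesis by (simp add: tv_dist_def numeral_2_eq_2)
  qed
  have "eps_far (doho_dist n) (grained (bitstrings n) m) \<epsilon> (map_pmf C P)"
    unfolding eps_far_def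
  proof
    fix Q assume "Q \<in> grained (bitstrings n) m"
    then obtain Q' where "Q' \<in> grained {..<2} m"
      and "1 / 2 / 2 * tv_dist {..<2} P Q' \<le> doho_dist n (map_pmf C P) Q"
      using code_doho_dist[OF C _ _ P] by (metis zero_less_numeral half_gt_zero_iff zero_less_one)
    then show "\<epsilon> < doho_dist n (map_pmf C P) Q" using tv[of Q'] assms(3) by simp
  qed
  moreover have "set_pmf (map_pmf C P) \<subseteq> bitstrings n" using C P by (auto simp: is_code_def)
  ultimately show ?thesis using that by blast
qed

text \<open>Without samples the verdict has the same distribution on every input, but it would have
  to accept a point mass and reject a far distribution, each with probability at least 2/3.\<close>

lemma no_zero_sample_tester:
  assumes "n > 0" "m > 0" "\<epsilon> < 1 / (16 * real m)"
  shows "\<not> is_tester (bitstrings n) (doho_dist n) (grained (bitstrings n) m) \<epsilon> (doho_out 0 T)"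
proof
  assume T: "is_tester (bitstrings n) (doho_dist n) (grained (bitstrings n) m) \<epsilon> (doho_out 0 T)"
  obtain P where P: "set_pmf P \<subseteq> bitstrings n"
    "eps_far (doho_dist n) (grained (bitstrings n) m) \<epsilon> P"
    using exists_far_from_grained[OF assms] by blast
  let ?R = "return_pmf (replicate n True)"
  have R: "replicate n True \<in> bitstrings n" by (simp add: bitstrings_def)
  have "doho_out 0 T P = doho_out 0 T ?R" by (simp add: doho_out_def)
  moreover have "pmf (doho_out 0 T ?R) True \<ge> 2 / 3"
    using T R return_pmf_grained[OF R \<open>m > 0\<close>] by (auto simp: is_tester_def)
  moreover have "pmf (doho_out 0 T P) False \<ge> 2 / 3"
    using T P by (auto simp: is_tester_def)
  moreover have "pmf (doho_out 0 T ?R) True + pmf (doho_out 0 T ?R) False = 1"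
    using sum_pmf_eq_1[OF finite subset_UNIV, of "doho_out 0 T ?R"]
    by (simp add: UNIV_bool add.commute)
  ultimately show False by simp
qed

section \<open>Combining large and small m\<close>

lemma real_div_log2_le:
  assumes "2 \<le> m"
  shows "real m / log 2 (real m) \<le> real m" and "0 \<le> real m / log 2 (real m)"
proof -
  have "1 \<le> log 2 (real m)" using assms by (simp add: le_log_iff)
  then show "real m / log 2 (real m) \<le> real m" "0 \<le> real m / log 2 (real m)"
    by (simp_all add: divide_le_eq mult_le_cancel_left1)
qed

theorem theorem2p12:
  fixes k :: "nat \<Rightarrow> nat" and \<epsilon>\<^sub>0 c\<^sub>0 :: real
  assumes "(\<lambda>m. real (k m)) \<in> O(\<lambda>m. real m)"
    and "\<epsilon>\<^sub>0 > 0" and "c\<^sub>0 > 0"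
    and "\<forall>\<^sub>F m in sequentially.
           std_sample_complexity {..<k m} (grained {..<k m} m) \<epsilon>\<^sub>0 \<ge> ereal (c\<^sub>0 * (real m / log 2 (real m)))"
  shows "\<forall>\<gamma>>0. \<exists>\<epsilon>>0. \<exists>c>0. \<forall>n m :: nat.
           2 \<le> m \<longrightarrow> real m \<le> 2 powr ((1 - \<gamma>) * real n) \<longrightarrow>
           doho_sample_complexity n (grained (bitstrings n) m) \<epsilon> \<ge> ereal (c * (real m / log 2 (real m)))"
proof (intro allI impI)
  fix \<gamma> :: real assume "\<gamma> > 0"
  show "\<exists>\<epsilon>>0. \<exists>c>0. \<forall>n m :: nat.
           2 \<le> m \<longrightarrow> real m \<le> 2 powr ((1 - \<gamma>) * real n) \<longrightarrow>
           doho_sample_complexity n (grained (bitstrings n) m) \<epsilon> \<ge> ereal (c * (real m / log 2 (real m)))"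
  proof (cases "\<gamma> < 1")
    case False
    \<comment> \<open>For \<gamma> >= 1 the size bound forces m <= 1, so the claim is
      vacuous.\<close>
    have "\<not> (2 \<le> m \<and> real m \<le> 2 powr ((1 - \<gamma>) * real n))" for n m :: nat
    proof
      assume *: "2 \<le> m \<and> real m \<le> 2 powr ((1 - \<gamma>) * real n)"
      have "2 powr ((1 - \<gamma>) * real n) \<le> 2 powr 0"
        using False by (intro powr_mono) (auto intro: mult_nonpos_nonneg)
      with * show False by simp
    qed
    then have "2 \<le> m \<Longrightarrow> \<not> real m \<le> 2 powr ((1 - \<gamma>) * real n)" for n m :: nat by blast
    then show ?thesis by (intro exI[of _ "1::real"] conjI) simp_all
  next
    case True
    obtain \<delta> where \<delta>: "\<delta> > 0"
      and codes: "\<And>n k. real k * 2 powr (\<gamma> / 2 * real n) \<le> 2 ^ n \<Longrightarrow> \<exists>C. is_code n k \<delta> C"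
      using constant_distance_codes[OF \<open>\<gamma> > 0\<close> True] by blast
    obtain K where "K > 0" and K: "\<forall>\<^sub>F m in sequentially. real (k m) \<le> K * real m"
      using landau_o.bigE[OF assms(1)] by auto
    \<comment> \<open>For large m the constant of the domain size is absorbed into a small power of
      m, which the spare bits can pay for.\<close>
    have "\<forall>\<^sub>F m in sequentially. K \<le> real m powr (\<gamma> / 2)"
      using \<open>\<gamma> > 0\<close> by real_asymp
    then have "\<forall>\<^sub>F m in sequentially. real (k m) \<le> K * real m \<and> K \<le> real m powr (\<gamma> / 2) \<and>
      ereal (c\<^sub>0 * (real m / log 2 (real m))) \<le> std_sample_complexity {..<k m} (grained {..<k m} m) \<epsilon>\<^sub>0"
      using K assms(4) by eventually_elim auto
    then obtain M where M: "\<And>m. m \<ge> M \<Longrightarrow> real (k m) \<le> K * real m"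
      "\<And>m. m \<ge> M \<Longrightarrow> K \<le> real m powr (\<gamma> / 2)"
      "\<And>m. m \<ge> M \<Longrightarrow> ereal (c\<^sub>0 * (real m / log 2 (real m)))
        \<le> std_sample_complexity {..<k m} (grained {..<k m} m) \<epsilon>\<^sub>0"
      by (auto simp: eventually_sequentially)
    \<comment> \<open>The first entry is what the reduction needs for m >= M, the second puts
      \<epsilon> below 1/(16m) for every m < M. Likewise the second entry of \<open>c\<close> makes
      the claimed bound at most 1 for m < M, where one sample is known to be necessary.\<close>
    define \<epsilon> where "\<epsilon> = min (\<delta> / 2 * \<epsilon>\<^sub>0) (1 / (16 * (real M + 1)))"
    define c where "c = min c\<^sub>0 (1 / (real M + 1))"
    have "\<epsilon> > 0" "c > 0" using \<delta> assms(2,3) by (auto simp: \<epsilon>_def c_def)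
    moreover have "ereal (c * (real m / log 2 (real m)))
        \<le> doho_sample_complexity n (grained (bitstrings n) m) \<epsilon>"
      if m: "2 \<le> m" "real m \<le> 2 powr ((1 - \<gamma>) * real n)" for n m
      unfolding doho_sample_complexity_def
    proof (rule INF_greatest, clarify)
      fix s T assume T: "is_tester (bitstrings n) (doho_dist n) (grained (bitstrings n) m) \<epsilon> (doho_out s T)"
      have "n > 0" using m by (cases n) auto
      show "ereal (c * (real m / log 2 (real m))) \<le> ereal (real s)"
      proof (cases "m < M")
        case True
        have "\<epsilon> < 1 / (16 * real m)"
        proof -
          have "1 / (16 * (real M + 1)) < 1 / (16 * real m)"
            using True m by (intro divide_strict_left_mono) auto
          then show ?thesis by (simp add: \<epsilon>_def)
        qed
        then have "s \<noteq> 0" using no_zero_sample_tester[OF \<open>n > 0\<close>, of m \<epsilon> T] T m by (intro notI) simp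
        have "c * (real m / log 2 (real m)) \<le> 1 / (real M + 1) * real m"
          using real_div_log2_le[OF m(1)] by (intro mult_mono) (auto simp: c_def)
        also have "\<dots> \<le> 1" using True by simp
        also have "\<dots> \<le> real s" using \<open>s \<noteq> 0\<close> by simp
        finally show ?thesis by simp
      next
        case False
        then have "m \<ge> M" by simp
        note M = M[OF this]
        have "K \<le> 2 powr (\<gamma> / 2 * n)"
        proof -
          have "real m \<le> 2 powr n"
            using m(2) \<open>\<gamma> > 0\<close> by (elim order_trans) (auto intro!: powr_mono simp: algebra_simps)
          then have "real m powr (\<gamma> / 2) \<le> (2 powr n) powr (\<gamma> / 2)"
            using \<open>\<gamma> > 0\<close> by (intro powr_mono2) auto
          then show ?thesis using M(2) by (simp add: powr_powr mult_ac)
        qed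
        \<comment> \<open>The exponents for the constant K, for m and for the ball size are \<gamma>
          n/2, (1 - \<gamma>) n and \<gamma> n/2, which add up to n.\<close>
        then have "K * real m * 2 powr (\<gamma> / 2 * n)
          \<le> 2 powr (\<gamma> / 2 * n) * 2 powr ((1 - \<gamma>) * n) * 2 powr (\<gamma> / 2 * n)"
          using m(2) by (intro mult_right_mono mult_mono) auto
        also have "\<dots> = 2 powr n"
          by (simp add: algebra_simps flip: powr_add)
        also have "\<dots> = 2 ^ n" by (simp add: powr_realpow)
        finally have "real (k m) * 2 powr (\<gamma> / 2 * n) \<le> 2 ^ n"
          using M(1) by (meson mult_right_mono order_trans powr_ge_zero)
        then obtain C where C: "is_code n (k m) \<delta> C" using codes by blast
        have "\<exists>T'. is_tester {..<k m} (tv_dist {..<k m}) (grained {..<k m} m) \<epsilon>\<^sub>0 (std_out s T')"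
        proof (cases "k m = 0")
          \<comment> \<open>No distribution has its support in the empty domain, so any
            \<open>T'\<close> is a tester.\<close>
          case True
          then show ?thesis by (simp add: is_tester_def set_pmf_not_empty)
        next
          case False
          then show ?thesis
            using std_tester_of_doho_tester[OF C \<delta> _ T] by (simp add: \<epsilon>_def)
        qed
        then have "std_sample_complexity {..<k m} (grained {..<k m} m) \<epsilon>\<^sub>0 \<le> ereal (real s)"
          unfolding std_sample_complexity_def by (intro INF_lower) simp
        with M(3) have "ereal (c\<^sub>0 * (real m / log 2 (real m))) \<le> ereal (real s)"
          by (rule order_trans)
        moreover have "c * (real m / log 2 (real m)) \<le> c\<^sub>0 * (real m / log 2 (real m))"
          using real_div_log2_le[OF m(1)] by (intro mult_right_mono) (auto simp: c_def)
        ultimately show ?thesis by simp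
      qed
    qed
    ultimately show ?thesis by blast
  qed
qed

end
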